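(* If $G$ is a Hamiltonian chordal graph that is $\{\text{bull}, K_{1,5}\}$-free or $\{\text{bull}, K_2 \vee P_5\}$-free, then $G$ is fully cycle extendable.
   Context: All graphs are finite, simple and undirected. The bull is the graph on $5$ vertices consisting of a triangle $xyz$ together with two further vertices $p,q$ and edges $xp$ and $yq$. $K_{1,5}$ is the star with $5$ leaves. $K_2 \vee P_5$ is the join of an edge and a path on $5$ vertices (all edges between the two vertices of $K_2$ and the five vertices of $P_5$ are added). For a set $\mathcal{H}$ of graphs, $G$ is $\mathcal{H}$-free if no induced subgraph of $G$ is isomorphic to a member of $\mathcal{H}$. A graph is chordal if it has no induced cycle of length $4$ or more; it is Hamiltonian if it has a cycle through all vertices. If $C$ is a cycle of length $m$ in $G$, an extension of $C$ is a cycle $C'$ of length $m+1$ with $V(C')\setminus V(C)=\{v\}$ for a single vertex $v$; $C$ is extendable if it has an extension. $G$ is cycle extendable if every non-Hamiltonian cycle of $G$ is extendable, and fully cycle extendable if in addition every vertex of $G$ lies on a triangle. *)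

theory Defs
  imports "Graph_Theory.Graph_Theory"
begin

text \<open>
  A finite simple undirected graph is a \<^typ>\<open>'a pair_pre_digraph\<close> satisfying
  \<^locale>\<open>pair_graph\<close>: each undirected edge is represented by its two arcs.
\<close>

text \<open>
  The library's notion of cycle admits the closed walk \<open>u, v, u\<close> along a single
  undirected edge, so length at least 3 has to be required in addition.
\<close>

definition is_cycle :: "'a pair_pre_digraph \<Rightarrow> ('a \<times> 'a) awalk \<Rightarrow> bool" where
  "is_cycle G C \<longleftrightarrow> pre_digraph.cycle (with_proj G) C \<and> 3 \<le> length C"

definition cycle_verts :: "('a \<times> 'a) awalk \<Rightarrow> 'a set" where
  "cycle_verts C = fst ` set C"

definition cycle_graph :: "('a \<times> 'a) awalk \<Rightarrow> 'a pair_pre_digraph" where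
  "cycle_graph C = mk_symmetric (with_proj \<lparr>pverts = cycle_verts C, parcs = set C\<rparr>)"

definition hamiltonian :: "'a pair_pre_digraph \<Rightarrow> bool" where
  "hamiltonian G \<longleftrightarrow> (\<exists>C. is_cycle G C \<and> cycle_verts C = pverts G)"

definition chordal :: "'a pair_pre_digraph \<Rightarrow> bool" where
  "chordal G \<longleftrightarrow>
     \<not> (\<exists>C. is_cycle G C \<and> 4 \<le> length C \<and>
            induced_subgraph (with_proj (cycle_graph C)) (with_proj G))"

definition is_extension ::
    "'a pair_pre_digraph \<Rightarrow> ('a \<times> 'a) awalk \<Rightarrow> ('a \<times> 'a) awalk \<Rightarrow> bool" where
  "is_extension G C C' \<longleftrightarrow>
     is_cycle G C' \<and> length C' = length C + 1 \<and>
     (\<exists>v. cycle_verts C' - cycle_verts C = {v})"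

definition extendable :: "'a pair_pre_digraph \<Rightarrow> ('a \<times> 'a) awalk \<Rightarrow> bool" where
  "extendable G C \<longleftrightarrow> (\<exists>C'. is_extension G C C')"

definition cycle_extendable :: "'a pair_pre_digraph \<Rightarrow> bool" where
  "cycle_extendable G \<longleftrightarrow>
     (\<forall>C. is_cycle G C \<and> cycle_verts C \<noteq> pverts G \<longrightarrow> extendable G C)"

definition fully_cycle_extendable :: "'a pair_pre_digraph \<Rightarrow> bool" where
  "fully_cycle_extendable G \<longleftrightarrow>
     cycle_extendable G \<and>
     (\<forall>v\<in>pverts G. \<exists>T. is_cycle G T \<and> length T = 3 \<and> v \<in> cycle_verts T)"

definition free_of :: "'b pair_pre_digraph set \<Rightarrow> 'a pair_pre_digraph \<Rightarrow> bool" where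
  "free_of \<H> G \<longleftrightarrow>
     (\<forall>H\<in>\<H>. \<not> (\<exists>K. induced_subgraph K (with_proj G) \<and> digraph_iso K (with_proj H)))"

definition complete_graph :: "'a set \<Rightarrow> 'a pair_pre_digraph" where
  "complete_graph V = \<lparr>pverts = V, parcs = {(u, v). u \<in> V \<and> v \<in> V \<and> u \<noteq> v}\<rparr>"

definition path_graph :: "'a list \<Rightarrow> 'a pair_pre_digraph" where
  "path_graph vs = mk_symmetric (with_proj \<lparr>pverts = set vs, parcs = set (zip vs (tl vs))\<rparr>)"

text \<open>The join is meant for graphs with disjoint vertex sets.\<close>

definition graph_join ::
    "'a pair_pre_digraph \<Rightarrow> 'a pair_pre_digraph \<Rightarrow> 'a pair_pre_digraph" where
  "graph_join G H =
     \<lparr>pverts = pverts G \<union> pverts H,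
      parcs = parcs G \<union> parcs H \<union> pverts G \<times> pverts H \<union> pverts H \<times> pverts G\<rparr>"

text \<open>The triangle is \<open>0, 1, 2\<close>; the pendant vertices are 3 and 4.\<close>

definition bull :: "nat pair_pre_digraph" where
  "bull = mk_symmetric (with_proj
     \<lparr>pverts = {0, 1, 2, 3, 4}, parcs = {(0, 1), (1, 2), (0, 2), (0, 3), (1, 4)}\<rparr>)"

definition K_1_5 :: "nat pair_pre_digraph" where
  "K_1_5 = mk_symmetric (with_proj
     \<lparr>pverts = {0, 1, 2, 3, 4, 5}, parcs = {0} \<times> {1, 2, 3, 4, 5}\<rparr>)"

definition K2_join_P5 :: "nat pair_pre_digraph" where
  "K2_join_P5 = graph_join (complete_graph {0, 1}) (path_graph [2, 3, 4, 5, 6])"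

lemma pair_graph_mk_symmetric:
  assumes "finite V" "A \<subseteq> V \<times> V" "irrefl A"
  shows "pair_graph (mk_symmetric (with_proj \<lparr>pverts = V, parcs = A\<rparr>))"
proof -
  have "parcs (mk_symmetric (with_proj \<lparr>pverts = V, parcs = A\<rparr>)) = A \<union> A\<inverse>"
    by (auto simp: mk_symmetric_def)
  moreover have "pverts (mk_symmetric (with_proj \<lparr>pverts = V, parcs = A\<rparr>)) = V"
    by (simp add: mk_symmetric_def)
  moreover have "finite A"
    using assms(1,2) by (meson finite_SigmaI finite_subset)
  ultimately show ?thesis
    using assms by unfold_locales (auto simp: symmetric_def sym_Un_converse irrefl_def)
qed

lemma pair_graph_bull: "pair_graph bull"
  unfolding bull_def by (rule pair_graph_mk_symmetric) (auto simp: irrefl_def)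

lemma complete_bipartite_K_1_5: "K\<^bsub>1,5\<^esub> (with_proj K_1_5)"
proof -
  have "finite (pverts K_1_5)" "pverts K_1_5 = {0} \<union> {1, 2, 3, 4, 5}"
    by (auto simp: K_1_5_def mk_symmetric_def)
  moreover have "parcs K_1_5 = {0} \<times> {1, 2, 3, 4, 5} \<union> {1, 2, 3, 4, 5} \<times> {0}"
    unfolding K_1_5_def mk_symmetric_def by (simp add: insert_Times_insert) blast
  moreover have "{0} \<inter> {1, 2, 3, 4, 5} = ({} :: nat set)"
    "card {0 :: nat} = 1" "card {1, 2, 3, 4, 5 :: nat} = 5"
    by simp_all
  ultimately show ?thesis
    unfolding complete_bipartite_digraph_pair_def by blast
qed

lemma pair_graph_graph_join:
  assumes "pair_graph G" "pair_graph H" "pverts G \<inter> pverts H = {}"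
  shows "pair_graph (graph_join G H)"
proof -
  interpret G: pair_graph G by fact
  interpret H: pair_graph H by fact
  have "sym (parcs G)" "sym (parcs H)"
    using G.pair_sym_arcs H.pair_sym_arcs by (simp_all add: symmetric_def)
  then have "sym (parcs (graph_join G H))"
    by (auto simp: graph_join_def sym_def)
  then show ?thesis
    using assms(3)
    by unfold_locales
      (auto simp: graph_join_def symmetric_def
        dest: G.arc_fst_in_verts G.arc_snd_in_verts H.arc_fst_in_verts H.arc_snd_in_verts
          G.pair_no_loops H.pair_no_loops)
qed

lemma pair_graph_complete_graph: "finite V \<Longrightarrow> pair_graph (complete_graph V)"
  by unfold_locales
    (auto simp: complete_graph_def symmetric_def sym_def
      intro: finite_subset[where B = "V \<times> V"])

lemma pair_graph_K2_join_P5: "pair_graph K2_join_P5"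
  unfolding K2_join_P5_def path_graph_def
  by (intro pair_graph_graph_join pair_graph_complete_graph pair_graph_mk_symmetric)
    (auto simp: complete_graph_def mk_symmetric_def irrefl_def)

end

theory Submission
  imports Defs
begin

text \<open>
  Let \<open>C\<close> be a non-extendable cycle with vertex set \<open>S\<close>, and write \<open>x\<^sup>+\<close> for the successor of \<open>x\<close>
  on \<open>C\<close>. For \<open>v\<close> outside \<open>S\<close>, the set consisting of \<open>v\<close> and the successors of its neighbours is
  independent. Suppose that non-adjacent \<open>x, y\<close> in \<open>S\<close> are joined by a path \<open>x, h\<^sub>1, \<dots>, h\<^sub>k, y\<close> with
  interior outside \<open>S\<close>, with \<open>k\<close> minimal. Since \<open>C\<close> minus a vertex is connected, chordality yields
  two adjacent vertices \<open>s, s'\<close> of \<open>S\<close> adjacent to the whole path. Bull-freeness makes \<open>s\<close> and \<open>s'\<close>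
  adjacent to \<open>x\<^sup>+\<close> and \<open>y\<^sup>+\<close> as well, and then \<open>s, s'\<close> together with the induced path
  \<open>x\<^sup>+, x, h\<^sub>1, \<dots>, h\<^sub>k, y, y\<^sup>+\<close> contain \<open>K\<^sub>2 \<or> P\<^sub>5\<close>, while one of \<open>s, s'\<close> is adjacent to all
  of the independent vertices \<open>h\<^sub>1, x\<^sup>+, y\<^sup>+, s\<^sup>+, s'\<^sup>+\<close>. Hence any two vertices of \<open>S\<close> joined through the
  outside are adjacent. A Hamiltonian cycle can therefore be shortcut to \<open>S\<close>, except that one of the
  excursions outside \<open>S\<close> is replaced by a single common neighbour of its two ends; the result
  is an extension of \<open>C\<close>.
\<close>

section \<open>Cycles and induced paths\<close>

locale adjacency =
  fixes E :: "'a \<Rightarrow> 'a \<Rightarrow> bool"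
  assumes E_sym: "E x y \<Longrightarrow> E y x"
    and E_irrefl: "\<not> E x x"
begin

lemma E_commute: "E x y \<longleftrightarrow> E y x"
  using E_sym by blast

lemma E_neq: "E x y \<Longrightarrow> x \<noteq> y"
  using E_irrefl by blast

definition cyc :: "'a list \<Rightarrow> bool" where
  "cyc xs \<longleftrightarrow> 3 \<le> length xs \<and> distinct xs \<and> successively E (xs @ [hd xs])"

text \<open>These are the vertex lists of induced paths. For empty \<open>xs\<close> the value of
  \<open>hd xs\<close> is immaterial, as the quantifier is vacuous.\<close>

primrec ipath :: "'a list \<Rightarrow> bool" where
  "ipath [] \<longleftrightarrow> True"
| "ipath (x # xs) \<longleftrightarrow> ipath xs \<and> x \<notin> set xs \<and> (\<forall>y\<in>set xs. E x y \<longleftrightarrow> y = hd xs)"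

lemma ipath_append:
  "ipath (xs @ ys) \<longleftrightarrow> ipath xs \<and> ipath ys \<and>
     (\<forall>x\<in>set xs. \<forall>y\<in>set ys. x \<noteq> y \<and> (E x y \<longleftrightarrow> x = last xs \<and> y = hd ys))"
proof (induction xs)
  case (Cons a xs)
  show ?case
  proof (cases xs)
    case Nil
    then show ?thesis by auto
  next
    case (Cons b bs)
    then have "last xs \<in> set xs" "hd xs \<in> set xs" "xs \<noteq> []" by simp_all
    then show ?thesis using Cons.IH by auto
  qed
qed simp

lemma ipath_rev [simp]: "ipath (rev xs) \<longleftrightarrow> ipath xs"
proof (induction xs)
  case (Cons a xs)
  then show ?case
    by (cases "xs = []") (auto simp: ipath_append last_rev E_commute)
qed simp

lemma ipath_distinct: "ipath xs \<Longrightarrow> distinct xs"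
  by (induction xs) auto

lemma ipath_walk: "ipath ps \<Longrightarrow> successively E ps"
proof (induction ps)
  case (Cons x ps)
  then show ?case by (cases ps) auto
qed simp

lemma ipath_adjacent_consecutive:
  "ipath ps \<Longrightarrow> a \<in> set ps \<Longrightarrow> b \<in> set ps \<Longrightarrow> E a b \<Longrightarrow>
   (a, b) \<in> set (zip ps (tl ps)) \<or> (b, a) \<in> set (zip ps (tl ps))"
proof (induction ps)
  case (Cons x ps)
  then show ?case
    using E_irrefl[of x] E_commute[of a x]
    by (cases ps) auto
qed simp

text \<open>Induction on the walk: an induced path for the tail is cut at \<open>x\<close> if
  \<open>x\<close> lies on it; otherwise \<open>x\<close> is joined to its last neighbour on it,
  which leaves no chord from \<open>x\<close>.\<close>

lemma walk_imp_ipath: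
  assumes "successively E ps" "ps \<noteq> []"
  shows "\<exists>qs. qs \<noteq> [] \<and> ipath qs \<and> hd qs = hd ps \<and> last qs = last ps \<and> set qs \<subseteq> set ps"
  using assms
proof (induction ps)
  case (Cons x ps)
  show ?case
  proof (cases "ps = []")
    case True
    then show ?thesis by (intro exI[of _ "[x]"]) simp
  next
    case False
    then have "successively E ps" using Cons.prems by (simp add: successively_Cons)
    from Cons.IH[OF this False] obtain qs where qs: "qs \<noteq> []" "ipath qs" "hd qs = hd ps"
      "last qs = last ps" "set qs \<subseteq> set ps"
      by blast
    show ?thesis
    proof (cases "x \<in> set qs")
      case True
      then obtain as bs where *: "qs = as @ x # bs" by (meson split_list)
      have "ipath (x # bs)" using qs(2) unfolding * ipath_append by blast
      moreover have "last (x # bs) = last (x # ps)" using qs(4) False unfolding * by simp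
      moreover have "set (x # bs) \<subseteq> set (x # ps)" using qs(5) unfolding * by auto
      ultimately show ?thesis by (intro exI[of _ "x # bs"]) simp
    next
      case x: False
      have "E x (hd ps)" using Cons.prems False by (simp add: successively_Cons)
      then have "\<exists>z\<in>set qs. E x z" using qs using hd_in_set[of qs] by auto
      then obtain as y bs where *: "qs = as @ y # bs" "E x y" "\<forall>z\<in>set bs. \<not> E x z"
        using split_list_last_prop[of qs "E x"] by blast
      have "ipath (y # bs)" using qs(2) unfolding * ipath_append by blast
      then have "ipath (x # y # bs)" using *(2,3) x unfolding *(1) by auto
      moreover have "last (x # y # bs) = last (x # ps)" using qs(4) False unfolding * by simp
      moreover have "set (x # y # bs) \<subseteq> set (x # ps)" using qs(5) unfolding * by auto
      ultimately show ?thesis by (intro exI[of _ "x # y # bs"]) simp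
    qed
  qed
qed simp

section \<open>Successors on a cycle\<close>

lemma cyc_rotate: "cyc (xs @ ys) \<Longrightarrow> cyc (ys @ xs)"
  unfolding cyc_def
  by (cases "xs = []"; cases "ys = []") (auto simp: successively_append_iff)

text \<open>Appending \<open>hd xs\<close> makes the successor of the last vertex wrap around to the
  first.\<close>

definition nxt :: "'a list \<Rightarrow> 'a \<Rightarrow> 'a" where
  "nxt xs x = hd (tl (dropWhile (\<lambda>y. y \<noteq> x) (xs @ [hd xs])))"

lemma nxt_split:
  assumes "distinct (xs @ x # ys)"
  shows "nxt (xs @ x # ys) x = hd (ys @ xs @ [x])"
proof -
  have *: "x \<notin> set xs" using assms by simp
  have "dropWhile (\<lambda>y. y \<noteq> x) (xs @ zs) = dropWhile (\<lambda>y. y \<noteq> x) zs" for zs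
    using * by (induction xs) auto
  then show ?thesis
    unfolding nxt_def by (cases xs; cases ys) auto
qed

lemma nxt_rotate:
  assumes "distinct (xs @ ys)" "x \<in> set xs \<union> set ys"
  shows "nxt (ys @ xs) x = nxt (xs @ ys) x"
proof -
  consider as bs where "xs = as @ x # bs" | as bs where "ys = as @ x # bs"
    using assms(2) by (meson UnE split_list)
  then show ?thesis
  proof cases
    case 1
    then show ?thesis
      using nxt_split[of as x "bs @ ys"] nxt_split[of "ys @ as" x "bs"] assms(1) by auto
  next
    case 2
    then show ?thesis
      using nxt_split[of "xs @ as" x bs] nxt_split[of as x "bs @ xs"] assms(1) by auto
  qed
qed

text \<open>Rotation changes neither the vertex set nor the successors, so an argument about one
  vertex of a cycle may assume that it comes first.\<close>

lemma cyc_start: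
  assumes "cyc cs" "x \<in> set cs"
  obtains t where "cyc (x # t)" "set (x # t) = set cs" "\<And>y. y \<in> set cs \<Longrightarrow> nxt (x # t) y = nxt cs y"
proof -
  obtain as bs where cs: "cs = as @ x # bs" using assms(2) by (meson split_list)
  have "cyc (x # bs @ as)" using cyc_rotate[of as "x # bs"] assms(1) cs by simp
  moreover have "nxt (x # bs @ as) y = nxt cs y" if "y \<in> set cs" for y
    using nxt_rotate[of as "x # bs" y] assms(1) cs that by (auto simp: cyc_def)
  ultimately show ?thesis using that[of "bs @ as"] cs by auto
qed

lemma nxt_Cons: "distinct (x # t) \<Longrightarrow> nxt (x # t) x = hd (t @ [x])"
  using nxt_split[of "[]" x t] by simp

lemma E_nxt:
  assumes "cyc cs" "x \<in> set cs"
  shows "E x (nxt cs x)" "nxt cs x \<in> set cs"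
proof -
  obtain t where t: "cyc (x # t)" "set (x # t) = set cs" "nxt (x # t) x = nxt cs x"
    using cyc_start assms by metis
  obtain y u where u: "t = y # u" using t(1) by (cases t) (auto simp: cyc_def)
  have "nxt cs x = y" using nxt_Cons[of x t] t(1) unfolding t(3)[symmetric] u cyc_def by simp
  moreover have "E x y" using t(1) unfolding u cyc_def by simp
  moreover have "y \<in> set cs" unfolding t(2)[symmetric] u by simp
  ultimately show "E x (nxt cs x)" "nxt cs x \<in> set cs" by simp_all
qed

text \<open>With \<open>x\<close> in front and the list split at \<open>y\<close>, the two
  successors are the heads of \<open>as @ [y]\<close> and \<open>bs @ [x]\<close>, which share no
  vertex.\<close>

lemma nxt_inj:
  assumes "cyc cs" "x \<in> set cs" "y \<in> set cs" "x \<noteq> y"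
  shows "nxt cs x \<noteq> nxt cs y"
proof -
  obtain t where t: "cyc (x # t)" "set (x # t) = set cs"
    "\<And>z. z \<in> set cs \<Longrightarrow> nxt (x # t) z = nxt cs z"
    using cyc_start[OF assms(1,2)] by blast
  from t(2) assms(3,4) have "y \<in> set t" by (metis set_ConsD)
  then obtain as bs where t': "t = as @ y # bs" by (meson split_list)
  have d: "distinct (x # as @ y # bs)" using t(1) unfolding t' cyc_def by simp
  have "nxt cs x = hd (as @ [y])"
    using nxt_Cons[of x t] d t(3)[OF assms(2)] unfolding t' by (cases as) auto
  moreover have "nxt cs y = hd (bs @ [x])"
    using nxt_split[of "x # as" y bs] d t(3)[OF assms(3)] unfolding t' by (cases bs) auto
  ultimately show ?thesis using d by (cases as; cases bs) auto
qed

text \<open>Deleting \<open>s\<close> leaves the rest of the cycle as one path \<open>t\<close>; the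
  segment of \<open>t\<close> between \<open>x\<close> and \<open>y\<close> is the required walk,
  reversed if \<open>y\<close> comes first.\<close>

lemma cyc_minus_walk:
  assumes "cyc cs" "s \<in> set cs" "x \<in> set cs - {s}" "y \<in> set cs - {s}"
  obtains ps where "ps \<noteq> []" "successively E ps" "hd ps = x" "last ps = y" "set ps \<subseteq> set cs - {s}"
proof -
  obtain t where t: "cyc (s # t)" "set (s # t) = set cs"
    using cyc_start assms(1,2) by metis
  have w: "successively E t" "distinct (s # t)"
    using t by (auto simp: cyc_def successively_append_iff successively_Cons)
  have xy: "x \<in> set t" "y \<in> set t" using assms t by auto
  obtain as bs where ab: "t = as @ x # bs" using xy by (meson split_list)
  have swE: "(\<lambda>x y. E y x) = E" using E_commute by blast
  consider "x = y" | us ds where "bs = us @ y # ds" | us ds where "as = us @ y # ds"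
    using xy ab by (metis Un_iff set_append set_ConsD split_list)
  then show ?thesis
  proof cases
    case 1
    then show ?thesis using that[of "[x]"] assms by auto
  next
    case 2
    then have t': "t = as @ (x # us @ [y]) @ ds" using ab by simp
    then have "successively E (x # us @ [y])"
      using w(1) by (simp only: successively_append_iff)
    moreover have "set (x # us @ [y]) \<subseteq> set cs - {s}"
      unfolding t(2)[symmetric] using w(2) t' by auto
    ultimately show ?thesis using that[of "x # us @ [y]"] by simp
  next
    case 3
    then have t': "t = us @ (y # ds @ [x]) @ bs" using ab by simp
    then have "successively E (y # ds @ [x])"
      using w(1) by (simp only: successively_append_iff)
    then have "successively E (rev (y # ds @ [x]))"
      unfolding successively_rev swE .
    moreover have "set (rev (y # ds @ [x])) \<subseteq> set cs - {s}"
      unfolding t(2)[symmetric] using w(2) t' by auto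
    ultimately show ?thesis using that[of "rev (y # ds @ [x])"] by simp
  qed
qed

end

section \<open>Chordal adjacency relations\<close>

text \<open>\<open>chord\<close> is chordality for the closed list \<open>v # ps\<close>: if
  \<open>v\<close> saw no vertex of \<open>butlast (tl ps)\<close>, the interior of
  \<open>ps\<close>, this would be an induced cycle of length at least 4.\<close>

locale chordal_adjacency = adjacency +
  assumes chord: "\<lbrakk>ipath ps; 3 \<le> length ps; v \<notin> set ps; E v (hd ps); E v (last ps)\<rbrakk>
    \<Longrightarrow> \<exists>z\<in>set (butlast (tl ps)). E v z"
begin

text \<open>A chord from \<open>v\<close> to an interior vertex \<open>w\<close> splits the path at
  \<open>w\<close> into two shorter induced paths whose ends are all neighbours of \<open>v\<close>,
  so induction on the length applies. Paths with fewer than three vertices consist of their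
  ends.\<close>

lemma fan:
  assumes "ipath ps" "ps \<noteq> []" "v \<notin> set ps" "E v (hd ps)" "E v (last ps)" "z \<in> set ps"
  shows "E v z"
  using assms
proof (induction "length ps" arbitrary: ps z rule: less_induct)
  case less
  show ?case
  proof (cases "length ps < 3")
    case True
    then consider a where "ps = [a]" | a b where "ps = [a, b]"
      using less.prems(2) by (cases ps; cases "tl ps"; cases "tl (tl ps)") auto
    then show ?thesis using less.prems by cases auto
  next
    case False
    then obtain a r where "ps = a # r" "r \<noteq> []" by (cases ps; cases "tl ps") auto
    then obtain m b where ps: "ps = a # m @ [b]" by (cases r rule: rev_cases) auto
    have "3 \<le> length ps" using False by simp
    from chord[OF less.prems(1) this less.prems(3-5)]
    obtain w where w: "w \<in> set m" "E v w" unfolding ps by auto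
    then obtain m1 m2 where m: "m = m1 @ w # m2" by (meson split_list)
    let ?l = "a # m1 @ [w]" and ?r = "w # m2 @ [b]"
    have "ipath (?l @ m2 @ [b])" "ipath ((a # m1) @ ?r)"
      using less.prems(1) unfolding ps m by simp_all
    then have "ipath ?l" "ipath ?r"
      unfolding ipath_append by blast+
    moreover have "z \<in> set ?l \<or> z \<in> set ?r"
      using less.prems(6) unfolding ps m by auto
    ultimately show ?thesis
      using less.hyps[of ?l z] less.hyps[of ?r z] less.prems(3-5) w(2) unfolding ps m by auto
  qed
qed

text \<open>Apply \<open>fan\<close> to an induced path from \<open>u\<close> to the last vertex of \<open>ps\<close>: its second vertex works.\<close>

lemma common_neighbour:
  assumes "E u w" "successively E ps" "ps \<noteq> []" "E u (hd ps)" "E w (last ps)"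
    and "u \<notin> set ps" "w \<notin> set ps"
  obtains a where "a \<in> set ps" "E a u" "E a w"
proof -
  have "successively E (u # ps)" using assms by (simp add: successively_Cons)
  from walk_imp_ipath[OF this] obtain qs where qs: "qs \<noteq> []" "ipath qs" "hd qs = u"
    "last qs = last ps" "set qs \<subseteq> insert u (set ps)"
    using assms(3) by auto
  have "last ps \<noteq> u" using assms(3,6) last_in_set by blast
  then obtain a t where t: "qs = u # a # t"
    using qs(1,3,4) by (cases qs; cases "tl qs") auto
  have a: "a \<in> set ps" "E u a" using qs(2,5) unfolding t by auto
  have "w \<notin> set qs" using qs(5) assms(7) E_neq[OF assms(1)] by auto
  then have "E w a"
    using fan[OF qs(2,1), of w a] qs(3,4) E_sym[OF assms(1)] assms(5) t by simp
  then show ?thesis using that a E_sym by blast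
qed

text \<open>For consecutive \<open>x, y\<close>, the rest of the cycle, read backwards, leads from a
  neighbour of \<open>x\<close> to a neighbour of \<open>y\<close>; \<open>common_neighbour\<close>
  supplies the third vertex.\<close>

lemma cyc_triangle:
  assumes "cyc cs" "x \<in> set cs"
  obtains y z where "cyc [x, y, z]"
proof -
  obtain t where t: "cyc (x # t)" using cyc_start assms by metis
  then obtain y r where r: "t = y # r" "r \<noteq> []"
    by (cases t; cases "tl t") (auto simp: cyc_def)
  have w: "E x y" "E y (hd r)" "successively E r" "E (last r) x" "distinct (x # y # r)"
    using t r by (auto simp: cyc_def successively_append_iff successively_Cons)
  have "successively E (rev r)" using w(3) E_commute
    by (metis (mono_tags, lifting) successively_mono successively_rev)
  with w r(2) E_sym obtain z where "z \<in> set (rev r)" "E z x" "E z y"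
    using common_neighbour[of x y "rev r"] by (auto simp: hd_rev last_rev)
  then have "cyc [x, y, z]" using w E_sym E_irrefl by (auto simp: cyc_def)
  then show ?thesis using that by blast
qed

end

section \<open>Non-extendable cycles in chordal bull-free graphs\<close>

text \<open>In \<open>bull_free\<close>, \<open>p\<close> and \<open>q\<close> are the horns at
  \<open>x\<close> and \<open>y\<close>; the listed adjacencies and non-adjacencies force the five
  vertices to be distinct.\<close>

locale chordal_bull_free_adjacency = chordal_adjacency +
  assumes bull_free:
    "\<lbrakk>E x y; E y z; E x z; E p x; E q y; \<not> E p y; \<not> E p z; \<not> E q x; \<not> E q z; \<not> E p q\<rbrakk> \<Longrightarrow> False"

text \<open>Non-extendability is expressed through vertex sets: a cycle with vertex set
  \<open>insert v (set cs)\<close> is automatically one longer than \<open>cs\<close>.\<close>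

locale stuck_cycle = chordal_bull_free_adjacency +
  fixes cs :: "'a list"
  assumes cyc_cs: "cyc cs"
    and stuck: "v \<notin> set cs \<Longrightarrow> cyc xs \<Longrightarrow> set xs \<noteq> insert v (set cs)"
begin

abbreviation S :: "'a set" where "S \<equiv> set cs"

abbreviation nx :: "'a \<Rightarrow> 'a" where "nx \<equiv> nxt cs"

lemmas nx_in = E_nxt(2)[OF cyc_cs]

lemmas E_nx = E_nxt(1)[OF cyc_cs]

lemmas nx_inj = nxt_inj[OF cyc_cs]

text \<open>Otherwise \<open>v\<close> could be inserted between \<open>x\<close> and
  \<open>nx x\<close>.\<close>

lemma not_E_nx:
  assumes "v \<notin> S" "x \<in> S" "E v x"
  shows "\<not> E v (nx x)" "\<not> E (nx x) v"
proof -
  obtain t where t: "cyc (x # t)" "set (x # t) = S" "nxt (x # t) x = nx x"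
    using cyc_start[OF cyc_cs assms(2)] assms(2) by metis
  obtain y u where u: "t = y # u" using t(1) by (cases t) (auto simp: cyc_def)
  have y: "nx x = y" using nxt_Cons[of x t] t(1) unfolding t(3)[symmetric] u cyc_def by simp
  show "\<not> E v (nx x)"
  proof
    assume "E v (nx x)"
    then have "cyc (x # v # t)"
      using t(1) assms E_sym[OF assms(3)] t(2) unfolding u y cyc_def by auto
    then show False using stuck[OF assms(1), of "x # v # t"] t(2) by auto
  qed
  then show "\<not> E (nx x) v" using E_sym by blast
qed

text \<open>Otherwise go from \<open>x\<close> via \<open>v\<close> to \<open>y\<close>, back along the cycle to \<open>nx x\<close>, across to \<open>nx y\<close>, and on to \<open>x\<close>.\<close>

lemma not_E_nx_nx:
  assumes "v \<notin> S" "x \<in> S" "y \<in> S" "E v x" "E v y"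
  shows "\<not> E (nx x) (nx y)"
proof (cases "x = y")
  case False
  obtain t where t: "cyc (x # t)" "set (x # t) = S"
    "\<And>z. z \<in> S \<Longrightarrow> nxt (x # t) z = nx z"
    using cyc_start[OF cyc_cs assms(2)] by blast
  from t(2) assms(3) False have "y \<in> set t" by (metis set_ConsD)
  then obtain as bs where t': "t = as @ y # bs" by (meson split_list)
  have d: "distinct (x # as @ y # bs)" using t(1) unfolding t' cyc_def by simp
  have nx: "nx x = hd (as @ [y])"
    using nxt_Cons[of x t] d t(3)[OF assms(2)] unfolding t' by (cases as) auto
  have ny: "nx y = hd (bs @ [x])"
    using nxt_split[of "x # as" y bs] d t(3)[OF assms(3)] unfolding t' by (cases bs) auto
  have ne: "as \<noteq> []" "bs \<noteq> []"
    using nx ny not_E_nx[OF assms(1,2,4)] not_E_nx[OF assms(1,3,5)] assms(4,5) by auto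
  show ?thesis
  proof
    assume e: "E (nx x) (nx y)"
    have w: "successively E (as @ [y])" "successively E (bs @ [x])"
      using t(1) unfolding t' cyc_def
      by (auto simp: successively_append_iff successively_Cons)
    have r: "successively E (rev (as @ [y]))" using w(1) E_commute
      by (metis (mono_tags, lifting) successively_mono successively_rev)
    have "successively E ((x # v # rev (as @ [y])) @ bs @ [x])"
      unfolding successively_append_iff[of E "x # v # rev (as @ [y])"]
      using r w(2) e ne assms(5) E_sym[OF assms(4)] nx ny by (simp add: last_rev)
    then have "cyc (x # v # rev (as @ [y]) @ bs)"
      using d assms(1) t(2) unfolding cyc_def t' by auto
    then show False
      using stuck[OF assms(1), of "x # v # rev (as @ [y]) @ bs"] t(2) t' by auto
  qed
qed (simp add: E_irrefl)

section \<open>Detours outside the cycle\<close>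

definition ladder :: "'a \<Rightarrow> 'a list \<Rightarrow> 'a \<Rightarrow> bool" where
  "ladder x hs y \<longleftrightarrow> x \<in> S \<and> y \<in> S \<and> hs \<noteq> [] \<and> set hs \<inter> S = {} \<and> ipath (x # hs @ [y])"

lemma ladder_rev: "ladder x hs y \<Longrightarrow> ladder y (rev hs) x"
  using ipath_rev[of "x # hs @ [y]"] unfolding ladder_def by simp

lemma ladderD:
  assumes "ladder x hs y"
  shows "x \<in> S" "y \<in> S" "x \<noteq> y" "\<not> E x y" "E x (hd hs)" "hd hs \<notin> S" "E (last hs) y" "last hs \<notin> S"
proof -
  have "hd hs \<in> set hs" "last hs \<in> set hs" "set hs \<inter> S = {}"
    using assms unfolding ladder_def by simp_all
  then have "hd hs \<notin> S" "last hs \<notin> S" by blast+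
  then show "x \<in> S" "y \<in> S" "x \<noteq> y" "\<not> E x y" "E x (hd hs)" "hd hs \<notin> S" "E (last hs) y" "last hs \<notin> S"
    using assms unfolding ladder_def by (auto simp: ipath_append)
qed

text \<open>\<open>nx x\<close> sees \<open>x\<close>, so a further neighbour \<open>h\<close> would
  by \<open>fan\<close> make it see the whole path from \<open>x\<close> to \<open>h\<close>, in
  particular \<open>hd hs\<close>, a common outside neighbour of \<open>x\<close> and
  \<open>nx x\<close>.\<close>

lemma nx_off_ladder:
  assumes L: "ladder x hs y" and h: "h \<in> set hs"
  shows "\<not> E (nx x) h"
proof
  assume e: "E (nx x) h"
  obtain a b where hs: "hs = a @ h # b" using h by (meson split_list)
  have p: "ipath (x # a @ [h])"
    using L ipath_append[of "x # a @ [h]" "b @ [y]"] unfolding ladder_def hs by simp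
  have S: "x \<in> S" "nx x \<in> S" "set hs \<inter> S = {}"
    using L nx_in unfolding ladder_def by auto
  have "nx x \<notin> set (x # a @ [h])" using S E_nx[of x] E_irrefl hs by auto
  then have "E (nx x) (hd hs)"
    using fan[OF p, of "nx x" "hd hs"] e E_sym[OF E_nx[OF S(1)]] hs by (cases a) auto
  then show False
    using not_E_nx(2)[of "hd hs" x] ladderD[OF L] E_sym by blast
qed

text \<open>By \<open>fan\<close>, a vertex that sees both ends of the detour sees its
  interior.\<close>

lemma no_common_neighbour_off_ladder:
  assumes L: "ladder x hs y" and w: "\<And>h. h \<in> set hs \<Longrightarrow> \<not> E w h" and "w \<in> S"
  shows "\<not> (E w x \<and> E w y)"
proof
  assume e: "E w x \<and> E w y"
  have "w \<notin> set (x # hs @ [y])" using e assms E_irrefl unfolding ladder_def by auto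
  then have "E w (hd hs)"
    using fan[of "x # hs @ [y]" w "hd hs"] L e unfolding ladder_def by auto
  then show False using w[of "hd hs"] L unfolding ladder_def by simp
qed

text \<open>The successors miss the interior by \<open>nx_off_ladder\<close>, hence the opposite
  ends as well by \<open>no_common_neighbour_off_ladder\<close>. An edge between them would by
  \<open>fan\<close> join \<open>nx y\<close> to \<open>x\<close>.\<close>

lemma nx_ladder:
  assumes L: "ladder x hs y"
  shows "ipath (nx x # x # hs @ [y, nx y])"
proof -
  note D = ladderD[OF L]
  note L' = ladder_rev[OF L]
  have hs: "set hs \<inter> S = {}" "hs \<noteq> []" "ipath (x # hs @ [y])" using L unfolding ladder_def by auto
  have nS: "nx x \<in> S" "nx y \<in> S" and ne: "E x (nx x)" "E y (nx y)" using D nx_in E_nx by auto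
  have x: "\<not> E (nx x) h" and y: "\<not> E (nx y) h" if "h \<in> set hs" for h
    using nx_off_ladder[OF L that] nx_off_ladder[OF L', of h] that by auto
  have xy: "\<not> E (nx x) y" and yx: "\<not> E (nx y) x"
    using no_common_neighbour_off_ladder[OF L x nS(1)]
      no_common_neighbour_off_ladder[OF L y nS(2)] ne E_sym by blast+
  have n: "nx x \<noteq> y" "nx y \<noteq> x" "nx x \<noteq> x" "nx y \<noteq> y" "nx x \<noteq> nx y"
    using D ne E_irrefl E_sym nx_inj[of x y] by metis+
  have P: "ipath (nx x # x # hs @ [y])"
    using hs nS n xy x E_sym[OF ne(1)] by auto
  have "\<not> E (nx y) (nx x)"
  proof
    assume "E (nx y) (nx x)"
    moreover have "nx y \<notin> set (nx x # x # hs @ [y])" using n hs nS by auto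
    ultimately have "E (nx y) x" using fan[OF P, of "nx y" x] E_sym[OF ne(2)] by simp
    then show False using yx by simp
  qed
  then have "ipath ((nx x # x # hs @ [y]) @ [nx y])"
    unfolding ipath_append[of "nx x # x # hs @ [y]"]
    using P n hs nS ne yx y E_sym by auto
  then show ?thesis by simp
qed

text \<open>If \<open>s\<close> missed \<open>nx x\<close>, excluding three bulls would force
  \<open>nx s\<close> to see both ends of the detour but none of its interior.\<close>

lemma dominator_nx:
  assumes L: "ladder x hs y" and s: "s \<in> S" and dom: "\<And>p. p \<in> set (x # hs @ [y]) \<Longrightarrow> E s p"
  shows "E s (nx x)"
proof (rule ccontr)
  assume nsx: "\<not> E s (nx x)"
  note D = ladderD[OF L]
  have h1: "hd hs \<in> set hs" "last hs \<in> set hs" using L unfolding ladder_def by auto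
  have e: "E s x" "E s y" "E s (hd hs)" "E s (last hs)" using dom h1 by auto
  have X: "z \<noteq> x \<Longrightarrow> \<not> E (nx x) z" if "z \<in> set (hs @ [y, nx y])" for z
    using nx_ladder[OF L] that by auto
  have Y: "z \<noteq> y \<Longrightarrow> \<not> E (nx y) z" if "z \<in> set (hs @ [x, nx x])" for z
    using nx_ladder[OF ladder_rev[OF L]] that by auto
  have ne: "hd hs \<noteq> x" "last hs \<noteq> x" "hd hs \<noteq> y" "last hs \<noteq> y" "nx y \<noteq> x"
    using h1 ipath_distinct[OF nx_ladder[OF L]] by auto
  have n1: "\<not> E (nx x) (nx y)" "\<not> E (nx x) y" "\<not> E (nx x) (hd hs)" "\<not> E (nx x) (last hs)"
    "\<not> E (nx y) x" "\<not> E (nx y) (hd hs)" "\<not> E (nx y) (last hs)"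
    using X[of "nx y"] X[of y] X[of "hd hs"] X[of "last hs"]
      Y[of x] Y[of "hd hs"] Y[of "last hs"] h1 ne D(3) by simp_all
  have E: "E x s" "E y s" "E x (hd hs)" "E y (last hs)" "E (nx x) x" "E (nx y) y"
    "\<not> E (nx x) s"
    using e D E_nx nsx E_sym by blast+
  \<comment> \<open>Triangle \<open>x, s, hd hs\<close> with horns \<open>nx x\<close> at
    \<open>x\<close> and \<open>nx y\<close> at \<open>s\<close>.\<close>
  have nsy: "\<not> E (nx y) s"
    using bull_free[of x s "hd hs" "nx x" "nx y"] E e n1 by blast
  have sn: "E (nx s) s" using E_nx s E_sym by blast
  have m: "\<not> E (nx s) h" if "h \<in> set hs" for h
  proof -
    have "h \<notin> S" using that L unfolding ladder_def by blast
    moreover have "E h s" using dom[of h] that E_sym by simp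
    ultimately show ?thesis using not_E_nx(2) s by blast
  qed
  have E': "E (hd hs) x" "E (hd hs) s" "E (last hs) y" "E (last hs) s" using E e E_sym by blast+
  have "\<not> E (nx x) (nx s)" using not_E_nx_nx[OF D(6) D(1) s E'(1,2)] .
  \<comment> \<open>Same triangle, now with horn \<open>nx s\<close> at \<open>s\<close>; only an
    edge from \<open>nx s\<close> to \<open>x\<close> can prevent the bull.\<close>
  then have "E (nx s) x"
    using bull_free[of x s "hd hs" "nx x" "nx s"] E e n1 sn m[OF h1(1)] by blast
  moreover have "\<not> E (nx y) (nx s)" using not_E_nx_nx[OF D(8) D(2) s E'(3,4)] .
  \<comment> \<open>The mirror image at \<open>y\<close>, with triangle
    \<open>y, s, last hs\<close>; this is where \<open>nsy\<close> enters.\<close>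
  then have "E (nx s) y"
    using bull_free[of y s "last hs" "nx y" "nx s"] E e n1 sn nsy m[OF h1(2)] by blast
  ultimately show False
    using no_common_neighbour_off_ladder[OF L m nx_in[OF s]] by blast
qed

text \<open>\<open>b\<close> dominates the detour \<open>a, v, c\<close> and \<open>c\<close>
  dominates \<open>b, v, d\<close>, so \<open>dominator_nx\<close> makes \<open>nx a\<close> and
  \<open>nx d\<close> horns of a bull on the triangle \<open>b, c, v\<close>.\<close>

lemma no_P4_in_outside_neighbourhood:
  assumes "v \<notin> S" "ipath [a, b, c, d]" "{a, b, c, d} \<subseteq> S" "E v a" "E v b" "E v c" "E v d"
  shows False
proof -
  have L1: "ladder a [v] c" and L2: "ladder b [v] d"
    using assms E_sym unfolding ladder_def by auto
  have "E b (nx a)"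
    using dominator_nx[OF L1, of b] assms E_sym by auto
  moreover have "E c (nx d)"
    using dominator_nx[OF ladder_rev[OF L2], of c] assms E_sym by auto
  moreover have "\<not> E (nx a) c" using nx_ladder[OF L1] by auto
  moreover have "\<not> E b (nx d)" using nx_ladder[OF L2] by auto
  moreover have "\<not> E (nx a) (nx d)" using not_E_nx_nx[of v a d] assms by simp
  moreover have "\<not> E (nx a) v" "\<not> E (nx d) v" using not_E_nx assms by simp_all
  ultimately show False
    using bull_free[of b c v "nx a" "nx d"] assms E_sym by auto
qed

text \<open>Looser than \<open>ladder\<close>: the walk may revisit vertices and have chords, and
  its ends may be adjacent. Minimality and the excursions of a larger cycle are stated in this
  form.\<close>

definition outer_walk :: "'a \<Rightarrow> 'a list \<Rightarrow> 'a \<Rightarrow> bool" where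
  "outer_walk x hs y \<longleftrightarrow> x \<in> S \<and> y \<in> S \<and> x \<noteq> y \<and> hs \<noteq> [] \<and> set hs \<inter> S = {} \<and>
     successively E (x # hs @ [y])"

text \<open>The freedom to avoid \<open>t\<close> is what later yields two different dominators. A
  detour with one interior vertex is handled by an induced path on the cycle, a longer one by
  minimality.\<close>

lemma dominator_exists:
  assumes L: "ladder x hs y"
    and min: "\<And>x' hs' y'. outer_walk x' hs' y' \<Longrightarrow> \<not> E x' y' \<Longrightarrow> length hs \<le> length hs'"
    and t: "t \<in> S" "t \<noteq> x" "t \<noteq> y"
  obtains s where "s \<in> S - {t}" "\<And>p. p \<in> set (x # hs @ [y]) \<Longrightarrow> E s p"
proof -
  have L': "hs \<noteq> []" "set hs \<inter> S = {}" "ipath (x # hs @ [y])" using L unfolding ladder_def by auto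
  note D = ladderD[OF L]
  obtain ws where ws: "ws \<noteq> []" "successively E ws" "hd ws = x" "last ws = y" "set ws \<subseteq> S - {t}"
    using cyc_minus_walk[OF cyc_cs t(1), of x y] D t by auto
  obtain v r where hs: "hs = v # r" using L'(1) by (cases hs) auto
  show ?thesis
  proof (cases r)
    case Nil
    \<comment> \<open>All of \<open>ps\<close> is seen by the single detour vertex \<open>v\<close>,
      so by \<open>no_P4_in_outside_neighbourhood\<close> it is \<open>x, a, y\<close>, and
      \<open>a\<close> is the dominator.\<close>
    obtain ps where ps: "ps \<noteq> []" "ipath ps" "hd ps = x" "last ps = y" "set ps \<subseteq> S - {t}"
      using walk_imp_ipath[OF ws(2,1)] ws(3-5) by auto
    have v: "v \<notin> S" "E v x" "E v y" using D E_sym unfolding hs Nil by auto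
    have Ev: "E v p" if "p \<in> set ps" for p
      using fan[OF ps(2,1) _ _ _ that, of v] v ps by auto
    obtain a q where a: "ps = x # a # q"
      using ps(1,3,4) D(3) by (cases ps; cases "tl ps") auto
    have "q \<noteq> []" using ps(2,4) D(4) unfolding a by auto
    then obtain b u where b: "q = b # u" by (cases q) auto
    have "u = []"
    proof (rule ccontr)
      assume "u \<noteq> []"
      then obtain c w where c: "u = c # w" by (cases u) auto
      have "ipath ([x, a, b, c] @ w)" using ps(2) unfolding a b c by simp
      then have "ipath [x, a, b, c]" unfolding ipath_append by blast
      then show False
        using no_P4_in_outside_neighbourhood[of v x a b c] v(1) Ev[of x] Ev[of a] Ev[of b] Ev[of c]
          ps(5) unfolding a b c by auto
    qed
    then have "b = y" using ps(4) unfolding a b by simp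
    then have "E a x" "E a y" "E a v" "a \<in> S - {t}"
      using ps(2,5) Ev[of a] E_sym unfolding a b by auto
    then show ?thesis using that[of a] unfolding hs Nil by auto
  next
    case (Cons w u)
    have P: "ipath (x # v # w # u @ [y])" using L'(3) unfolding hs Cons by simp
    have sw: "successively E (w # u @ [y])" using ipath_walk[OF P] by simp
    then have wu: "successively E (u @ [y])" "E w (hd (u @ [y]))"
      by (auto simp: successively_Cons)
    have "successively E (rev (u @ [y]))" using wu(1) E_commute
      by (metis (mono_tags, lifting) successively_mono successively_rev)
    then have "successively E (y # rev u)" by simp
    \<comment> \<open>From \<open>x\<close> along the cycle to \<open>y\<close>, then back along the
      detour to a neighbour of \<open>w\<close>: a walk to which \<open>common_neighbour\<close>
      applies for the edge \<open>v, w\<close>.\<close>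
    then have "successively E (ws @ rev u)"
      using ws by (auto simp: successively_append_iff successively_Cons)
    moreover have "last (ws @ rev u) = hd (u @ [y])" using ws(4) by (cases u) auto
    moreover have "hd (ws @ rev u) = x" using ws(1,3) by simp
    moreover have vw: "v \<notin> S" "w \<notin> S" "set u \<inter> S = {}" using L'(2) unfolding hs Cons by auto
    moreover have "v \<notin> set u" "w \<notin> set u" "E v w" "E v x"
      using P E_sym by auto
    ultimately obtain s where s: "s \<in> set ws \<union> set u" "E s v" "E s w"
      using common_neighbour[of v w "ws @ rev u"] wu(2) ws(1,5) by auto
    have "\<not> E v z" if "z \<in> set u" for z using P that by auto
    \<comment> \<open>\<open>v\<close> sees nothing in \<open>u\<close>, so \<open>s\<close> lies on
      \<open>ws\<close>.\<close>
    then have sS: "s \<in> S - {t}" using s ws(5) E_sym by blast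
    have "\<not> E x w" "\<not> E v y" using P by auto
    then have sxy: "s \<noteq> x" "s \<noteq> y" using s E_sym by blast+
    \<comment> \<open>If \<open>s\<close> missed \<open>x\<close> or \<open>y\<close>, then
      \<open>[v]\<close> or \<open>w # u\<close> would be a detour shorter than \<open>hs\<close>
      with non-adjacent ends.\<close>
    have "E x s"
    proof (rule ccontr)
      assume "\<not> E x s"
      moreover have "outer_walk x [v] s"
        using sS sxy D vw s E_sym P unfolding outer_walk_def by auto
      ultimately show False using min[of x "[v]" s] unfolding hs Cons by simp
    qed
    moreover have "E s y"
    proof (rule ccontr)
      assume "\<not> E s y"
      moreover have "outer_walk s (w # u) y"
        using sS sxy D vw s sw unfolding outer_walk_def by auto
      ultimately show False using min[of s "w # u" y] unfolding hs Cons by simp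
    qed
    moreover have "s \<notin> set (x # hs @ [y])" using sxy sS L'(2) by auto
    ultimately have "E s p" if "p \<in> set (x # hs @ [y])" for p
      using fan[OF L'(3), of s p] that E_sym by auto
    then show ?thesis using that sS by blast
  qed
qed

text \<open>Both obstructions come from one shortest detour, so either forbidden-subgraph hypothesis
  refutes it: \<open>s, s'\<close> and \<open>ps\<close> form the join, \<open>c\<close> and
  \<open>ls\<close> the star.\<close>

lemma obstruction:
  assumes "outer_walk x\<^sub>0 hs\<^sub>0 y\<^sub>0" "\<not> E x\<^sub>0 y\<^sub>0"
  obtains s s' ps c ls where "length ps = 5" "ipath ps" "E s s'"
      "\<And>p. p \<in> set ps \<Longrightarrow> E s p \<and> E s' p"
    and "length ls = 5" "distinct ls" "\<And>l. l \<in> set ls \<Longrightarrow> E c l"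
      "\<And>k l. k \<in> set ls \<Longrightarrow> l \<in> set ls \<Longrightarrow> \<not> E k l"
proof -
  define Q where "Q = (\<lambda>(x, hs, y). outer_walk x hs y \<and> \<not> E x y)"
  \<comment> \<open>The minimum is over all pairs of ends at once, since
    \<open>dominator_exists\<close> compares with detours between other ends.\<close>
  obtain x hs1 y where m: "Q (x, hs1, y)"
    "\<And>x' hs' y'. Q (x', hs', y') \<Longrightarrow> length hs1 \<le> length hs'"
    using ex_has_least_nat[of Q "(x\<^sub>0, hs\<^sub>0, y\<^sub>0)" "\<lambda>(x, hs, y). length hs"] assms
    unfolding Q_def by fastforce
  have w: "x \<in> S" "y \<in> S" "x \<noteq> y" "hs1 \<noteq> []" "set hs1 \<inter> S = {}"
    "successively E (x # hs1 @ [y])" "\<not> E x y"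
    using m(1) unfolding Q_def outer_walk_def by auto
  from walk_imp_ipath[OF w(6)] obtain qs where qs: "qs \<noteq> []" "ipath qs" "hd qs = x" "last qs = y"
    "set qs \<subseteq> set (x # hs1 @ [y])" by auto
  then obtain r where "qs = x # r" "r \<noteq> []" using w(3) by (cases qs; cases "tl qs") auto
  then obtain hs where Q: "qs = x # hs @ [y]" using qs(4) by (cases r rule: rev_cases) auto
  have hs: "hs \<noteq> []" using qs(2) w(7) unfolding Q by auto
  have d: "distinct qs" using ipath_distinct[OF qs(2)] .
  have sub: "set hs \<subseteq> set hs1" using qs(5) d unfolding Q by auto
  have "length hs = card (set hs)" using d unfolding Q by (simp add: distinct_card)
  also have "\<dots> \<le> card (set hs1)" using sub by (simp add: card_mono)
  also have "\<dots> \<le> length hs1" by (rule card_length)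
  finally have len: "length hs \<le> length hs1" .
  have L: "ladder x hs y" using w qs(2) hs sub unfolding ladder_def Q by auto
  \<comment> \<open>The extracted induced path is no longer than the minimal walk, so it inherits
    minimality.\<close>
  have min: "length hs \<le> length hs'" if "outer_walk x' hs' y'" "\<not> E x' y'" for x' hs' y'
    using m(2)[of x' hs' y'] len that unfolding Q_def by simp
  note D = ladderD[OF L]
  have ex: "\<exists>s\<in>S - {t}. \<forall>p\<in>set (x # hs @ [y]). E s p" if "t \<in> S" "t \<noteq> x" "t \<noteq> y" for t
    by (rule dominator_exists[OF L _ that]) (rule min, assumption+, blast)
  \<comment> \<open>A third vertex of the cycle serves as the avoided vertex for finding
    \<open>s\<close>; then \<open>s\<close> itself is avoided to find \<open>s'\<close>.\<close>
  have "\<not> set cs \<subseteq> {x, y}"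
  proof
    assume "set cs \<subseteq> {x, y}"
    then have "card (set cs) \<le> card {x, y}" by (intro card_mono) auto
    also have "\<dots> \<le> 2" by (simp add: card_insert_if)
    finally show False using cyc_cs distinct_card[of cs] unfolding cyc_def by simp
  qed
  then obtain t where "t \<in> S" "t \<noteq> x" "t \<noteq> y" by blast
  from ex[OF this] obtain s where
    s: "s \<in> S" "\<And>p. p \<in> set (x # hs @ [y]) \<Longrightarrow> E s p" by blast
  have "s \<noteq> x" "s \<noteq> y" using s(2)[of x] s(2)[of y] E_irrefl by auto
  from ex[OF s(1) this] obtain s' where
    s': "s' \<in> S" "s' \<noteq> s" "\<And>p. p \<in> set (x # hs @ [y]) \<Longrightarrow> E s' p" by blast
  have ss: "E s s'"
  proof -
    \<comment> \<open>Since \<open>x\<close> and \<open>y\<close> are non-adjacent,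
      \<open>x, s', y\<close> is an induced path, and \<open>fan\<close> from \<open>s\<close> gives
      the edge.\<close>
    have "ipath [x, s', y]" using s'(3)[of x] s'(3)[of y] D E_irrefl E_sym by auto
    moreover have "s \<notin> set [x, s', y]" using \<open>s \<noteq> x\<close> \<open>s \<noteq> y\<close> s'(2) by auto
    ultimately show ?thesis using fan[of "[x, s', y]" s s'] s(2)[of x] s(2)[of y] by auto
  qed
  have nx: "E z (nx x) \<and> E z (nx y)"
    if "z \<in> S" "\<And>p. p \<in> set (x # hs @ [y]) \<Longrightarrow> E z p" for z
  proof -
    have "p \<in> set (y # rev hs @ [x]) \<Longrightarrow> E z p" for p using that(2)[of p] by auto
    then show ?thesis using dominator_nx[OF L that] dominator_nx[OF ladder_rev[OF L] that(1)] by blast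
  qed
  let ?P = "nx x # x # hs @ [y, nx y]"
  \<comment> \<open>\<open>hs\<close> is nonempty, so \<open>?P\<close> has at least five vertices;
    a prefix of an induced path is induced.\<close>
  define ps where "ps = take 5 ?P"
  have P: "ipath ?P" using nx_ladder[OF L] .
  have "?P = ps @ drop 5 ?P" unfolding ps_def by (rule append_take_drop_id[symmetric])
  with P have ip: "ipath ps" using ipath_append by metis
  have lp: "length ps = 5" using hs unfolding ps_def by (cases hs) auto
  have "set ps \<subseteq> set ?P" unfolding ps_def by (rule set_take_subset)
  then have pp: "E s p \<and> E s' p" if "p \<in> set ps" for p
    using that s s' nx[OF s] nx[OF s'(1,3)] by auto
  let ?h = "hd hs" and ?l = "last hs"
  have hl: "?h \<in> set hs" "?l \<in> set hs" "?h \<notin> S" "?l \<notin> S" using hs D by auto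
  have h: "E ?h x" "E ?h s" "E ?h s'" "E ?l y" "E ?l s" "E ?l s'"
    using D s(2)[of ?h] s'(3)[of ?h] s(2)[of ?l] s'(3)[of ?l] hl E_sym by auto
  define ls where "ls = [?h, nx x, nx y, nx s, nx s']"
  have S: "nx x \<in> S" "nx y \<in> S" "nx s \<in> S" "nx s' \<in> S" using D s s' nx_in by auto
  have "s \<noteq> x" "s \<noteq> y" "s' \<noteq> x" "s' \<noteq> y"
    using s(2)[of x] s(2)[of y] s'(3)[of x] s'(3)[of y] E_irrefl by auto
  then have dist: "distinct ls"
    using S hl D(1-3) s(1) s'(1,2) nx_inj unfolding ls_def by auto
  have nh: "\<not> E (nx x) ?h" "\<not> E (nx y) ?h" "\<not> E (nx s) ?h" "\<not> E (nx s') ?h"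
    using nx_off_ladder[OF L hl(1)] nx_off_ladder[OF ladder_rev[OF L], of ?h] hl(1)
      not_E_nx(2)[OF hl(3) s(1) h(2)] not_E_nx(2)[OF hl(3) s'(1) h(3)] by auto
  \<comment> \<open>\<open>x\<close> and \<open>y\<close> need not have a common outside neighbour,
    so this pair is read off the induced path. The pairs in \<open>nn\<close> have one, namely
    \<open>hd hs\<close> or \<open>last hs\<close>.\<close>
  have xy: "\<not> E (nx x) (nx y)" using P ipath_distinct[OF P] by auto
  have nn: "\<not> E (nx x) (nx s)" "\<not> E (nx x) (nx s')" "\<not> E (nx y) (nx s)" "\<not> E (nx y) (nx s')"
    "\<not> E (nx s) (nx s')"
    using not_E_nx_nx hl(3,4) D(1,2) s(1) s'(1) h by blast+
  have indep: "\<not> E k l" if "k \<in> set ls" "l \<in> set ls" for k l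
    using that nh xy nn E_irrefl E_sym unfolding ls_def by (auto; blast)
  have n: "E s (nx s)" "E s' (nx s')" "E s (nx x)" "E s (nx y)" "E s' (nx x)" "E s' (nx y)"
    using E_nx s(1) s'(1) nx[OF s] nx[OF s'(1,3)] by auto
  \<comment> \<open>Otherwise \<open>nx s\<close> and \<open>nx s'\<close> are horns of a bull on
    \<open>s, s', hd hs\<close>. Whichever of \<open>s, s'\<close> sees both of these successors
    becomes the centre \<open>c\<close>.\<close>
  have "E s (nx s') \<or> E s' (nx s)"
  proof (rule ccontr)
    assume "\<not> (E s (nx s') \<or> E s' (nx s))"
    then have "\<not> E (nx s) s'" "\<not> E (nx s') s" using E_sym by blast+
    moreover have "E s ?h" "E s' ?h" "E (nx s) s" "E (nx s') s'" using h n E_sym by blast+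
    ultimately show False
      using bull_free[of s s' ?h "nx s" "nx s'"] ss nh nn by blast
  qed
  then obtain c where "\<And>l. l \<in> set ls \<Longrightarrow> E c l"
    using n h E_sym unfolding ls_def by auto
  moreover have "length ls = 5" unfolding ls_def by simp
  ultimately show ?thesis using that[OF lp ip ss pp _ dist _ indep] by blast
qed

text \<open>The excursion of \<open>Z\<close> through an outside vertex \<open>u\<close> is replaced
  by one common neighbour of its ends, and every other excursion is cut out; the resulting cycle
  contradicts \<open>stuck\<close>.\<close>

lemma outer_walk_adjacent_imp_spanning:
  assumes adj: "\<And>x hs y. outer_walk x hs y \<Longrightarrow> E x y"
    and Z: "cyc Z" and S: "S \<subseteq> set Z"
  shows "S = set Z"
proof (rule ccontr)
  assume "S \<noteq> set Z"
  then obtain u where u: "u \<in> set Z" "u \<notin> S" using S by blast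
  obtain t where t: "cyc (u # t)" "set (u # t) = set Z" using cyc_start[OF Z u(1)] by metis
  have St: "S \<subseteq> set t" using S t(2) u(2) by auto
  have "cs \<noteq> []" using cyc_cs unfolding cyc_def by auto
  then have "\<exists>q\<in>set t. q \<in> S" using St by (metis hd_in_set subsetD)
  then obtain a q b where q: "t = a @ q # b" "q \<in> S" "\<forall>z\<in>set b. z \<notin> S"
    using split_list_last_prop[of t "\<lambda>q. q \<in> S"] by blast
  \<comment> \<open>\<open>S\<close> has at least three vertices, so \<open>Z\<close> meets it in a
    vertex \<open>q'\<close> other than \<open>q\<close>.\<close>
  have "\<not> S \<subseteq> {q}"
  proof
    assume "S \<subseteq> {q}"
    then have "card S \<le> card {q}" by (intro card_mono) auto
    then show False using cyc_cs distinct_card[of cs] unfolding cyc_def by simp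
  qed
  then have "\<exists>q\<in>set a. q \<in> S" using St q by auto
  then obtain c q' d where q': "a = c @ q' # d" "q' \<in> S" "\<forall>z\<in>set c. z \<notin> S"
    using split_list_first_prop[of a "\<lambda>q. q \<in> S"] by blast
  \<comment> \<open>Starting from \<open>u\<close>, \<open>q'\<close> is the first and
    \<open>q\<close> the last vertex of \<open>S\<close>; read cyclically, \<open>hs\<close> is the
    whole excursion from \<open>q\<close> through \<open>u\<close> to \<open>q'\<close>.\<close>
  define hs where "hs = b @ u # c"
  have "cyc ((u # a) @ q # b)" using t(1) unfolding q by simp
  from cyc_rotate[OF this] have Z': "cyc (q # hs @ q' # d)" unfolding q' hs_def by simp
  have hs: "hs \<noteq> []" "set hs \<inter> S = {}" using q q' u unfolding hs_def by auto
  have dist: "distinct (q # hs @ q' # d)" using Z' unfolding cyc_def by simp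
  have "successively E ((q # hs @ [q']) @ d @ [q])" "successively E ((q # hs) @ (q' # d @ [q]))"
    using Z' unfolding cyc_def by simp_all
  then have s1: "successively E (q # hs @ [q'])" and s2: "successively E (q' # d @ [q])"
    unfolding successively_append_iff by blast+
  have "outer_walk q hs q'" using q q' hs dist s1 unfolding outer_walk_def by auto
  then have "E q q'" by (rule adj)
  moreover have h: "successively E hs" "E q (hd hs)" "E q' (last hs)"
    using s1 hs(1) E_sym by (auto simp: successively_append_iff successively_Cons)
  ultimately obtain v where v: "v \<in> set hs" "E v q" "E v q'"
    using common_neighbour[of q q' hs] hs(1) dist by auto
  \<comment> \<open>Consecutive survivors of the filter are adjacent in the walk or joined by an
    outer walk, hence adjacent by \<open>adj\<close>.\<close>
  have filt: "successively E (filter (\<lambda>z. z \<in> S) ps)" if "successively E ps" "distinct ps" for ps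
    using that
  proof (induction ps)
    case (Cons x ps)
    have IH: "successively E (filter (\<lambda>z. z \<in> S) ps)"
      using Cons by (auto simp: successively_Cons)
    show ?case
    proof (cases "x \<in> S \<and> (\<exists>z\<in>set ps. z \<in> S)")
      case True
      then obtain k y l where y: "ps = k @ y # l" "y \<in> S" "\<forall>z\<in>set k. z \<notin> S"
        using split_list_first_prop[of ps "\<lambda>q. q \<in> S"] by blast
      have "successively E ((x # k @ [y]) @ l)" using Cons.prems(1) unfolding y by simp
      then have w: "successively E (x # k @ [y])" unfolding successively_append_iff by blast
      have "E x y"
      proof (cases "k = []")
        case False
        then have "outer_walk x k y"
          using w True y Cons.prems(2) unfolding outer_walk_def by auto
        then show ?thesis by (rule adj)
      qed (use w in simp)
      moreover have "filter (\<lambda>z. z \<in> S) k = []" using y(3) by (simp add: filter_empty_conv)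
      ultimately show ?thesis using IH True y(2) unfolding y(1) by simp
    next
      case False
      then have "x \<notin> S \<or> filter (\<lambda>z. z \<in> S) ps = []" by (auto simp: filter_empty_conv)
      then show ?thesis using IH by auto
    qed
  qed simp
  let ?f = "filter (\<lambda>z. z \<in> S) d"
  let ?C = "q # v # q' # ?f"
  have "successively E (filter (\<lambda>z. z \<in> S) (q' # d @ [q]))"
    using filt[OF s2] dist by auto
  then have "successively E (q' # ?f @ [q])" using q(2) q'(2) by simp
  moreover have vS: "v \<notin> S" using v hs by auto
  ultimately have "cyc ?C" using v E_sym dist q(2) unfolding cyc_def by auto
  moreover have "set ?C = insert v S"
  proof -
    have "S \<subseteq> insert q (insert q' (set d))"
      using St q q' by auto
    then show ?thesis using q(2) q'(2) by auto
  qed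
  ultimately show False using stuck[OF vS, of ?C] by blast
qed

end

section \<open>Transfer to graphs\<close>

text \<open>The closed arc walk of a cyclic vertex list; its tails give the list back by
  \<open>map_fst_arcs_of\<close>.\<close>

definition arcs_of :: "'a list \<Rightarrow> ('a \<times> 'a) list" where
  "arcs_of xs = zip xs (tl xs @ [hd xs])"

lemma length_arcs_of: "xs \<noteq> [] \<Longrightarrow> length (arcs_of xs) = length xs"
  by (simp add: arcs_of_def)

lemma map_fst_arcs_of: "map fst (arcs_of xs) = xs"
  by (cases xs) (simp_all add: arcs_of_def)

lemma cycle_verts_arcs_of: "cycle_verts (arcs_of xs) = set xs"
  unfolding cycle_verts_def by (metis list.set_map map_fst_arcs_of)

lemma pcas_zip: "pcas u (zip (u # t) (t @ [w])) w"
  by (induction t arbitrary: u) auto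

lemma pawalk_verts_zip: "pawalk_verts u (zip (u # t) (t @ [w])) = u # t @ [w]"
  by (induction t arbitrary: u) auto

lemma successively_zip:
  "successively E (u # t @ [w]) \<longleftrightarrow> (\<forall>(x, y)\<in>set (zip (u # t) (t @ [w])). E x y)"
  by (induction t arbitrary: u) auto

text \<open>Converse of \<open>pcas_zip\<close>: consecutive arcs fit together, so the tails and the
  final vertex determine the walk.\<close>

lemma pcas_imp_zip:
  "pcas u C w \<Longrightarrow> C \<noteq> [] \<Longrightarrow> hd (map fst C) = u \<and> C = zip (map fst C) (tl (map fst C) @ [w])"
proof (induction C arbitrary: u)
  case (Cons e C)
  show ?case
  proof (cases "C = []")
    case True
    then show ?thesis using Cons.prems by (cases e) auto
  next
    case False
    with Cons have IH: "hd (map fst C) = snd e" "C = zip (map fst C) (tl (map fst C) @ [w])" by auto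
    from False obtain y D where "map fst C = y # D" by (cases C) auto
    then show ?thesis using Cons.prems IH by (cases e) auto
  qed
qed simp

lemma zip_snoc: "zip (u # t) (t @ [w]) = zip (u # t) t @ [(last (u # t), w)]"
  by (induction t arbitrary: u) auto

abbreviation adj :: "'a pair_pre_digraph \<Rightarrow> 'a \<Rightarrow> 'a \<Rightarrow> bool" where
  "adj G x y \<equiv> (x, y) \<in> parcs G"

lemma adjacency_adj:
  assumes "pair_graph G"
  shows "adjacency (adj G)"
proof
  interpret pair_graph G by fact
  show "adj G x y \<Longrightarrow> adj G y x" for x y
    using pair_sym_arcs by (auto simp: symmetric_def sym_def)
  show "\<not> adj G x x" for x
    using pair_no_loops by fastforce
qed

lemma adj_in_pverts:
  assumes "pair_graph G" "adj G x y"
  shows "x \<in> pverts G" "y \<in> pverts G"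
proof -
  interpret pair_graph G by fact
  show "x \<in> pverts G" "y \<in> pverts G"
    using arc_fst_in_verts[OF assms(2)] arc_snd_in_verts[OF assms(2)] by simp_all
qed

lemma is_cycle_iff_cyc:
  assumes "pair_graph G"
  shows "is_cycle G C \<longleftrightarrow> (\<exists>xs. adjacency.cyc (adj G) xs \<and> C = arcs_of xs)"
proof -
  interpret pair_graph G by fact
  interpret A: adjacency "adj G" using adjacency_adj assms .
  show ?thesis
  proof
    assume "is_cycle G C"
    then obtain u where u: "set C \<subseteq> parcs G" "pcas u C u" "distinct (tl (pawalk_verts u C))"
      "C \<noteq> []" "3 \<le> length C"
      unfolding is_cycle_def cycle_def awalk_def by auto
    define xs where "xs = map fst C"
    have xs: "hd xs = u" "C = zip xs (tl xs @ [u])" "3 \<le> length xs"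
      using pcas_imp_zip[OF u(2,4)] u(5) unfolding xs_def by auto
    then obtain t where t: "xs = u # t" by (cases xs) auto
    have C: "C = zip (u # t) (t @ [u])" using xs(2) unfolding t by simp
    \<comment> \<open>The vertex sequence of the walk is \<open>u # t @ [u]\<close>, whose tail is a
      rotation of \<open>xs\<close>.\<close>
    have "distinct xs" using u(3) unfolding C pawalk_verts_zip t by simp
    moreover have "successively (adj G) (u # t @ [u])"
      using u(1) unfolding successively_zip C[symmetric] by auto
    ultimately have "A.cyc xs" using xs(3) unfolding A.cyc_def t by simp
    then show "\<exists>xs. A.cyc xs \<and> C = arcs_of xs" using xs unfolding arcs_of_def by auto
  next
    assume "\<exists>xs. A.cyc xs \<and> C = arcs_of xs"
    then obtain xs where xs: "A.cyc xs" "C = arcs_of xs" by blast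
    then obtain u t where t: "xs = u # t" unfolding A.cyc_def by (cases xs) auto
    have C: "C = zip (u # t) (t @ [u])" using xs(2) unfolding arcs_of_def t by simp
    have "successively (adj G) (u # t @ [u])" using xs(1) unfolding A.cyc_def t by simp
    then have sub: "set C \<subseteq> parcs G" unfolding successively_zip C by auto
    have ne: "C \<noteq> []" unfolding C by (cases t) auto
    have "fst (hd C) = u" unfolding C by (cases t) auto
    then have "u \<in> pverts G" using sub ne arc_fst_in_verts hd_in_set by blast
    then have "cycle C"
      unfolding cycle_def awalk_def using sub ne pcas_zip[of u t u] pawalk_verts_zip[of u t u] xs(1)
      unfolding C A.cyc_def t by (intro exI[of _ u]) auto
    then show "is_cycle G C"
      using xs length_arcs_of[of xs] unfolding is_cycle_def A.cyc_def by fastforce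
  qed
qed

text \<open>Without such a neighbour, the arcs of \<open>G\<close> on \<open>v # ps\<close> are just
  those of the cycle, which is then induced and of length at least 4.\<close>

lemma chordal_imp_chord:
  assumes G: "pair_graph G" and "chordal G"
    and ps: "adjacency.ipath (adj G) ps" "3 \<le> length ps" "v \<notin> set ps"
      "adj G v (hd ps)" "adj G v (last ps)"
  shows "\<exists>z\<in>set (butlast (tl ps)). adj G v z"
proof (rule ccontr)
  interpret pair_graph G by fact
  interpret A: adjacency "adj G" using adjacency_adj G .
  assume no: "\<not> (\<exists>z\<in>set (butlast (tl ps)). adj G v z)"
  let ?C = "arcs_of (v # ps)"
  have ne: "ps \<noteq> []" using ps(2) by auto
  have cases: "z = hd ps \<or> z = last ps \<or> z \<in> set (butlast (tl ps))" if "z \<in> set ps" for z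
    using that by (cases ps; cases "tl ps" rule: rev_cases) auto
  have "successively (adj G) ps" using A.ipath_walk[OF ps(1)] .
  then have cyc: "A.cyc (v # ps)"
    using ps A.ipath_distinct A.E_sym ne
    by (auto simp: A.cyc_def successively_Cons successively_append_iff)
  then have iC: "is_cycle G ?C" using is_cycle_iff_cyc[OF G] by blast
  have C: "?C = (v, hd ps) # zip ps (tl ps @ [v])"
    using ne by (cases ps) (simp_all add: arcs_of_def)
  have sub: "set ?C \<subseteq> parcs G"
    using iC unfolding is_cycle_def cycle_def awalk_def by auto
  have vC: "cycle_verts ?C = set (v # ps)" by (rule cycle_verts_arcs_of)
  have vsub: "set (v # ps) \<subseteq> pverts G"
  proof -
    have "fst ` set ?C \<subseteq> pverts G" using sub arc_fst_in_verts by blast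
    then show ?thesis using vC unfolding cycle_verts_def by simp
  qed
  have "snd ` set ?C \<subseteq> set (v # ps)"
    unfolding arcs_of_def using set_zip_rightD ne by fastforce
  then have C2: "set ?C \<subseteq> set (v # ps) \<times> set (v # ps)"
    using subset_fst_snd[of "set ?C"] vC unfolding cycle_verts_def by blast
  have parcs: "parcs (cycle_graph ?C) = set ?C \<union> (set ?C)\<inverse>"
    unfolding cycle_graph_def parcs_mk_symmetric by auto
  have z: "set (zip ps (tl ps)) \<subseteq> set (zip ps (tl ps @ [v]))" "(last ps, v) \<in> set (zip ps (tl ps @ [v]))"
    using ne zip_snoc[of "hd ps" "tl ps" v] by (simp_all add: subset_insertI)
  \<comment> \<open>\<open>v\<close> sees only the two ends of \<open>ps\<close>, its neighbours on
    the cycle.\<close>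
  have v: "(v, b) \<in> set ?C \<or> (b, v) \<in> set ?C" if "adj G v b" "b \<in> set ps" for b
    using cases[OF that(2)] no that z(2) unfolding C by auto
  have ar: "(a, b) \<in> set ?C \<or> (b, a) \<in> set ?C"
    if ab: "adj G a b" "a \<in> set (v # ps)" "b \<in> set (v # ps)" for a b
  proof -
    consider "a = v" "b \<in> set ps" | "b = v" "a \<in> set ps" | "a \<in> set ps" "b \<in> set ps"
      using ab A.E_irrefl by auto
    then show ?thesis
    proof cases
      case 3
      then show ?thesis
        using A.ipath_adjacent_consecutive[OF ps(1) 3 ab(1)] z(1) unfolding C by auto
    qed (use v ab A.E_sym in blast)+
  qed
  have "parcs (cycle_graph ?C) = {e \<in> parcs G. fst e \<in> set (v # ps) \<and> snd e \<in> set (v # ps)}"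
    (is "_ = ?R")
  proof
    show "parcs (cycle_graph ?C) \<subseteq> ?R"
      unfolding parcs using sub C2 A.E_sym by auto
    show "?R \<subseteq> parcs (cycle_graph ?C)"
    proof
      fix e assume "e \<in> ?R"
      then have "e \<in> set ?C \<or> (snd e, fst e) \<in> set ?C"
        using ar[of "fst e" "snd e"] by simp
      then show "e \<in> parcs (cycle_graph ?C)" unfolding parcs by (cases e) simp
    qed
  qed
  moreover have "pverts (cycle_graph ?C) = set (v # ps)"
    unfolding cycle_graph_def using vC by simp
  moreover have "wf_digraph (with_proj (cycle_graph ?C))"
    using C2 parcs calculation(2) by unfold_locales auto
  ultimately have "induced_subgraph (with_proj (cycle_graph ?C)) (with_proj G)"
    using vsub wf_digraph_axioms unfolding induced_subgraph_def subgraph_def compatible_def by auto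
  moreover have "4 \<le> length ?C" using ps(2) by (simp add: length_arcs_of)
  ultimately show False using assms(2) iC unfolding chordal_def by blast
qed

text \<open>\<open>free_of\<close> asks for an isomorphism from the induced subgraph to
  \<open>H\<close>, so the map used is the inverse \<open>g\<close> of the embedding
  \<open>f\<close>.\<close>

lemma not_free_ofI:
  assumes G: "pair_graph G" and H: "H \<in> \<H>"
    and f: "inj_on f (pverts H)" "f ` pverts H \<subseteq> pverts G"
    and wf: "parcs H \<subseteq> pverts H \<times> pverts H"
    and iff: "\<And>u v. u \<in> pverts H \<Longrightarrow> v \<in> pverts H \<Longrightarrow> adj G (f u) (f v) \<longleftrightarrow> adj H u v"
  shows "\<not> free_of \<H> G"
proof -
  interpret pair_graph G by fact
  let ?V = "f ` pverts H"
  define K where "K = with_proj \<lparr>pverts = ?V, parcs = parcs G \<inter> ?V \<times> ?V\<rparr>"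
  have wfK: "wf_digraph K" unfolding K_def by unfold_locales auto
  have "induced_subgraph K (with_proj G)"
    using wfK wf_digraph_axioms f(2)
    unfolding induced_subgraph_def subgraph_def compatible_def by (auto simp: K_def)
  moreover
  define g where "g = the_inv_into (pverts H) f"
  define hom where "hom = \<lparr>iso_verts = g, iso_arcs = map_prod g g, iso_head = snd, iso_tail = fst\<rparr>"
  have g: "g (f u) = u" if "u \<in> pverts H" for u
    unfolding g_def using the_inv_into_f_f[OF f(1) that] .
  have gV: "inj_on g ?V" unfolding g_def using inj_on_the_inv_into[OF f(1)] .
  have "inj_on (map_prod g g) (?V \<times> ?V)" using map_prod_inj_on[OF gV gV] .
  then have "inj_on (map_prod g g) (parcs G \<inter> ?V \<times> ?V)" by (rule inj_on_subset) blast
  then have "pre_digraph.digraph_isomorphism K hom"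
    unfolding pre_digraph.digraph_isomorphism_def hom_def using wfK gV by (auto simp: K_def)
  moreover have "with_proj H = app_iso hom K"
  proof -
    have "g ` ?V = pverts H" using g by force
    moreover have "map_prod g g ` (parcs G \<inter> ?V \<times> ?V) = parcs H"
    proof
      show "map_prod g g ` (parcs G \<inter> ?V \<times> ?V) \<subseteq> parcs H" using g iff by auto
      show "parcs H \<subseteq> map_prod g g ` (parcs G \<inter> ?V \<times> ?V)"
      proof
        fix e assume e: "e \<in> parcs H"
        then obtain a b where ab: "e = (a, b)" "a \<in> pverts H" "b \<in> pverts H" using wf by auto
        then have "e = map_prod g g (f a, f b)" "(f a, f b) \<in> parcs G \<inter> ?V \<times> ?V"
          using g iff e by auto
        then show "e \<in> map_prod g g ` (parcs G \<inter> ?V \<times> ?V)" by blast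
      qed
    qed
    ultimately show ?thesis by (simp add: app_iso_def with_proj_def hom_def K_def)
  qed
  ultimately show ?thesis using H unfolding free_of_def digraph_iso_def by blast
qed

section \<open>Embeddings of the three forbidden graphs\<close>

lemma parcs_bull: "parcs bull =
    {(1, 4), (4, 1), (0, 3), (3, 0), (0, 2), (2, 0), (1, 2), (2, 1), (0, 1), (1, 0)}"
  and pverts_bull: "pverts bull = {0, 1, 2, 3, 4}"
  by (simp_all add: bull_def parcs_mk_symmetric)

lemma parcs_K_1_5: "parcs K_1_5 = {0} \<times> {1, 2, 3, 4, 5} \<union> {1, 2, 3, 4, 5} \<times> {0}"
  and pverts_K_1_5: "pverts K_1_5 = {0, 1, 2, 3, 4, 5}"
  by (simp_all add: K_1_5_def mk_symmetric_def insert_Times_insert) blast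

lemma parcs_K2_join_P5: "parcs K2_join_P5 =
    {(u, v). u \<in> {0, 1} \<and> v \<in> {0, 1} \<and> u \<noteq> v} \<union>
    {(5, 6), (6, 5), (4, 5), (5, 4), (3, 4), (4, 3), (2, 3), (3, 2)} \<union>
    {0, 1} \<times> {2, 3, 4, 5, 6} \<union> {2, 3, 4, 5, 6} \<times> {0, 1}"
proof -
  have "parcs (path_graph [2, 3, 4, 5, 6 :: nat]) =
      {(5, 6), (6, 5), (4, 5), (5, 4), (3, 4), (4, 3), (2, 3), (3, 2)}"
    by (simp add: path_graph_def parcs_mk_symmetric)
  moreover have "pverts (path_graph [2, 3, 4, 5, 6 :: nat]) = {2, 3, 4, 5, 6}"
    by (simp add: path_graph_def)
  ultimately show ?thesis
    by (simp only: K2_join_P5_def graph_join_def complete_graph_def pair_pre_digraph.simps)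
qed

lemma pverts_K2_join_P5: "pverts K2_join_P5 = {0, 1, 2, 3, 4, 5, 6}"
  by (auto simp: K2_join_P5_def graph_join_def complete_graph_def path_graph_def)

lemma free_of_bull:
  assumes G: "pair_graph G" "free_of \<H> G" "bull \<in> \<H>"
    and "adj G x y" "adj G y z" "adj G x z" "adj G p x" "adj G q y"
    and "\<not> adj G p y" "\<not> adj G p z" "\<not> adj G q x" "\<not> adj G q z" "\<not> adj G p q"
  shows False
proof -
  interpret pair_graph G by fact
  interpret A: adjacency "adj G" using adjacency_adj G(1) .
  have e: "adj G y x" "adj G z y" "adj G z x" "adj G x p" "adj G y q"
    "\<not> adj G y p" "\<not> adj G z p" "\<not> adj G x q" "\<not> adj G z q" "\<not> adj G q p"
    using assms A.E_sym by blast+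
  have d: "distinct [x, y, z, p, q]" using assms(4-) e A.E_irrefl by auto
  \<comment> \<open>List positions follow the numbering of \<open>bull\<close>: triangle 0, 1, 2,
    with 3 attached to 0 and 4 to 1.\<close>
  let ?f = "(!) [x, y, z, p, q]"
  have "inj_on ?f (pverts bull)" using d unfolding pverts_bull inj_on_def by auto
  moreover have "?f ` pverts bull \<subseteq> pverts G"
    using assms(4,5,7,8)[THEN adj_in_pverts(1)[OF G(1)]] assms(5)[THEN adj_in_pverts(2)[OF G(1)]]
    unfolding pverts_bull by simp
  moreover have "\<forall>u\<in>pverts bull. \<forall>v\<in>pverts bull. adj G (?f u) (?f v) \<longleftrightarrow> adj bull u v"
    unfolding pverts_bull parcs_bull by (simp add: assms(4-) e A.E_irrefl)
  moreover have "parcs bull \<subseteq> pverts bull \<times> pverts bull" unfolding parcs_bull pverts_bull by simp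
  ultimately show False using not_free_ofI[OF G(1,3), of ?f] G(2) by blast
qed

lemma free_of_K_1_5:
  assumes G: "pair_graph G" "free_of \<H> G" "K_1_5 \<in> \<H>"
    and ls: "length ls = 5" "distinct ls" "\<And>l. l \<in> set ls \<Longrightarrow> adj G c l"
      "\<And>k l. k \<in> set ls \<Longrightarrow> l \<in> set ls \<Longrightarrow> \<not> adj G k l"
  shows False
proof -
  interpret pair_graph G by fact
  interpret A: adjacency "adj G" using adjacency_adj G(1) .
  obtain l1 l2 l3 l4 l5 where l: "ls = [l1, l2, l3, l4, l5]"
    using ls(1) by (auto simp: length_Suc_conv numeral_eq_Suc)
  have e: "adj G l c" if "l \<in> set ls" for l using ls(3)[OF that] A.E_sym by blast
  have d: "distinct (c # ls)" using ls A.E_irrefl by auto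
  \<comment> \<open>Position 0 is the centre of the star.\<close>
  let ?f = "(!) (c # ls)"
  have "inj_on ?f (pverts K_1_5)" using d unfolding pverts_K_1_5 inj_on_def l by auto
  moreover have "?f ` pverts K_1_5 \<subseteq> pverts G"
    using adj_in_pverts[OF G(1) ls(3)] unfolding pverts_K_1_5 l by auto
  moreover have "\<forall>u\<in>pverts K_1_5. \<forall>v\<in>pverts K_1_5. adj G (?f u) (?f v) \<longleftrightarrow> adj K_1_5 u v"
    using e ls(3,4) unfolding pverts_K_1_5 parcs_K_1_5 l by (simp add: A.E_irrefl)
  moreover have "parcs K_1_5 \<subseteq> pverts K_1_5 \<times> pverts K_1_5" unfolding parcs_K_1_5 pverts_K_1_5 by auto
  ultimately show False using not_free_ofI[OF G(1,3), of ?f] G(2) by blast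
qed

lemma free_of_K2_join_P5:
  assumes G: "pair_graph G" "free_of \<H> G" "K2_join_P5 \<in> \<H>"
    and ps: "length ps = 5" "adjacency.ipath (adj G) ps" "adj G s s'"
      "\<And>p. p \<in> set ps \<Longrightarrow> adj G s p \<and> adj G s' p"
  shows False
proof -
  interpret pair_graph G by fact
  interpret A: adjacency "adj G" using adjacency_adj G(1) .
  obtain a b c d k where l: "ps = [a, b, c, d, k]"
    using ps(1) by (auto simp: length_Suc_conv numeral_eq_Suc)
  have e: "adj G s p" "adj G s' p" "adj G p s" "adj G p s'" if "p \<in> set [a, b, c, d, k]" for p
    using ps(4)[of p] that A.E_sym unfolding l by blast+
  have s: "adj G s' s" using ps(3) A.E_sym by blast
  have di: "distinct (s # s' # ps)" using ps A.E_irrefl A.ipath_distinct by auto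
  have in1: "adj G a b" "adj G b c" "adj G c d" "adj G d k"
    "\<not> adj G a c" "\<not> adj G a d" "\<not> adj G a k" "\<not> adj G b d" "\<not> adj G b k" "\<not> adj G c k"
    using ps(2) di unfolding l by auto
  then have in2: "adj G b a" "adj G c b" "adj G d c" "adj G k d"
    "\<not> adj G c a" "\<not> adj G d a" "\<not> adj G k a" "\<not> adj G d b" "\<not> adj G k b" "\<not> adj G k c"
    using A.E_sym by blast+
  \<comment> \<open>Positions 0 and 1 carry the edge, positions 2 to 6 the path.\<close>
  let ?f = "(!) (s # s' # ps)"
  have "inj_on ?f (pverts K2_join_P5)" using di unfolding pverts_K2_join_P5 inj_on_def l by auto
  moreover have "set (s # s' # ps) \<subseteq> pverts G"
    using adj_in_pverts[OF G(1) ps(3)] adj_in_pverts(2)[OF G(1), of s] ps(4) by auto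
  then have "?f ` pverts K2_join_P5 \<subseteq> pverts G"
    unfolding pverts_K2_join_P5 l by auto
  moreover have "\<forall>u\<in>pverts K2_join_P5. \<forall>v\<in>pverts K2_join_P5.
      adj G (?f u) (?f v) \<longleftrightarrow> adj K2_join_P5 u v"
    unfolding pverts_K2_join_P5 parcs_K2_join_P5 l
    by (simp add: ps(3) e s in1 in2 A.E_irrefl)
  moreover have "parcs K2_join_P5 \<subseteq> pverts K2_join_P5 \<times> pverts K2_join_P5"
    unfolding pverts_K2_join_P5 parcs_K2_join_P5 by auto
  ultimately show False using not_free_ofI[OF G(1,3), of ?f] G(2) by blast
qed

theorem theorem3p7:
  fixes G :: "'a pair_pre_digraph"
  assumes "pair_graph G"
    and "hamiltonian G"
    and "chordal G"
    and "free_of {bull, K_1_5} G \<or> free_of {bull, K2_join_P5} G"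
  shows "fully_cycle_extendable G"
proof -
  interpret adjacency "adj G" using adjacency_adj assms(1) .
  interpret chordal_bull_free_adjacency "adj G"
  proof
    show "\<exists>z\<in>set (butlast (tl ps)). adj G v z"
      if "ipath ps" "3 \<le> length ps" "v \<notin> set ps" "adj G v (hd ps)" "adj G v (last ps)" for ps v
      using chordal_imp_chord[OF assms(1,3) that] .
    show False
      if "adj G x y" "adj G y z" "adj G x z" "adj G p x" "adj G q y" "\<not> adj G p y"
        "\<not> adj G p z" "\<not> adj G q x" "\<not> adj G q z" "\<not> adj G p q" for x y z p q
      using assms(4) free_of_bull[OF assms(1) _ _ that] by blast
  qed
  note cycle_iff = is_cycle_iff_cyc[OF assms(1)]
  obtain Z where Z: "cyc Z" "set Z = pverts G"
    using assms(2) cycle_verts_arcs_of unfolding hamiltonian_def cycle_iff by metis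
  have "extendable G C" if C: "is_cycle G C" "cycle_verts C \<noteq> pverts G" for C
  proof (rule ccontr)
    assume no: "\<not> extendable G C"
    obtain cs where cs: "cyc cs" "C = arcs_of cs" using C(1) cycle_iff by blast
    interpret stuck_cycle "adj G" cs
    proof
      show "cyc cs" by (fact cs)
      fix v xs assume v: "v \<notin> set cs" "cyc xs"
      show "set xs \<noteq> insert v (set cs)"
      proof
        assume eq: "set xs = insert v (set cs)"
        \<comment> \<open>Both lists are distinct, so their lengths are the sizes of the vertex
          sets.\<close>
        have "length xs = length cs + 1"
          using eq v cs(1) distinct_card[of xs] distinct_card[of cs] unfolding cyc_def by simp
        moreover have "xs \<noteq> []" "cs \<noteq> []" using v(2) cs(1) unfolding cyc_def by auto
        moreover have "is_cycle G (arcs_of xs)" using v(2) cycle_iff by blast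
        moreover have "set xs - set cs = {v}" using eq v(1) by auto
        ultimately have "is_extension G C (arcs_of xs)"
          unfolding is_extension_def cs(2) cycle_verts_arcs_of by (simp add: length_arcs_of)
        then show False using no unfolding extendable_def by blast
      qed
    qed
    have outer_adj: "adj G x y" if "outer_walk x hs y" for x hs y
    proof (rule ccontr)
      assume "\<not> adj G x y"
      from obstruction[OF that this] show False
        using assms(4) free_of_K_1_5[OF assms(1)] free_of_K2_join_P5[OF assms(1)] by (metis insertI1 insertI2)
    qed
    have "set cs \<subseteq> set Z"
    proof
      fix x assume "x \<in> set cs"
      then show "x \<in> set Z"
        unfolding Z(2) using adj_in_pverts(1)[OF assms(1) E_nx] by blast
    qed
    from outer_walk_adjacent_imp_spanning[OF _ Z(1) this] have "set cs = set Z"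
      using outer_adj by blast
    then show False using C(2) Z(2) unfolding cs(2) cycle_verts_arcs_of by simp
  qed
  moreover have "\<exists>T. is_cycle G T \<and> length T = 3 \<and> v \<in> cycle_verts T" if "v \<in> pverts G" for v
  proof -
    have "v \<in> set Z" using that Z(2) by simp
    then obtain y z where "cyc [v, y, z]" by (rule cyc_triangle[OF Z(1)])
    then have "is_cycle G (arcs_of [v, y, z])" using cycle_iff by blast
    then show ?thesis
      by (intro exI[of _ "arcs_of [v, y, z]"]) (simp add: length_arcs_of cycle_verts_arcs_of)
  qed
  ultimately show ?thesis unfolding fully_cycle_extendable_def cycle_extendable_def by blast
qed

end
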